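(* Let $K$ be a field of characteristic different from $2$ and $3$, and let $A$ be a finite-dimensional Jacobi-Jordan algebra over $K$. Then $A$ is a commutative nilalgebra and a Jordan algebra.
   Context: An algebra over a field $K$ is a $K$-vector space with a bilinear product $x\cdot y$; neither associativity nor a unit is assumed. A Jacobi-Jordan algebra is an algebra $A$ over $K$ satisfying $x\cdot y=y\cdot x$ and $x\cdot(y\cdot z)+y\cdot(z\cdot x)+z\cdot(x\cdot y)=0$ for all $x,y,z\in A$. The principal powers of $x\in A$ are defined by $x^1=x$ and $x^{i+1}=x\cdot x^i$. The algebra $A$ is a nilalgebra (of nilindex $n$) if $y^n=0$ for all $y\in A$ for some positive integer $n$ (and there exists $x\in A$ with $x^{n-1}\neq 0$). A Jordan algebra is a commutative algebra satisfying $x^2\cdot(y\cdot x)=(x^2\cdot y)\cdot x$ for all $x,y$. *)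

theory Defs
  imports Complex_Main
begin

text \<open>An algebra has all of the type \<open>'v\<close> as its underlying vector space; the product \<open>mul\<close> is a
  separate operation, so that no associativity or unit comes in through a type class.\<close>

locale nonassoc_algebra = vector_space scale
  for scale :: "'k::field \<Rightarrow> 'v::ab_group_add \<Rightarrow> 'v" +
  fixes mul :: "'v \<Rightarrow> 'v \<Rightarrow> 'v" (infixl \<open>\<cdot>\<close> 70)
  assumes linear_mul_right: "\<And>x. Vector_Spaces.linear scale scale (\<lambda>y. x \<cdot> y)"
    and linear_mul_left: "\<And>y. Vector_Spaces.linear scale scale (\<lambda>x. x \<cdot> y)"

definition finite_dimensional :: "('k::field \<Rightarrow> 'v::ab_group_add \<Rightarrow> 'v) \<Rightarrow> bool" where
  "finite_dimensional scale \<longleftrightarrow> (\<exists>Basis. finite_dimensional_vector_space scale Basis)"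

locale commutative_algebra = nonassoc_algebra +
  assumes mul_comm: "x \<cdot> y = y \<cdot> x"

locale jacobi_jordan_algebra = commutative_algebra +
  assumes jacobi: "x \<cdot> (y \<cdot> z) + y \<cdot> (z \<cdot> x) + z \<cdot> (x \<cdot> y) = 0"

locale jordan_algebra = commutative_algebra +
  assumes jordan_identity: "(x \<cdot> x) \<cdot> (y \<cdot> x) = ((x \<cdot> x) \<cdot> y) \<cdot> x"

text \<open>Principal powers start at exponent 1; \<open>principal_power mul x 0\<close> is a junk value (equal to
  \<open>x\<close>, as there is no unit).\<close>

definition principal_power :: "('v \<Rightarrow> 'v \<Rightarrow> 'v) \<Rightarrow> 'v \<Rightarrow> nat \<Rightarrow> 'v" where
  "principal_power mul x n = (mul x ^^ (n - 1)) x"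

lemma principal_power_1: "principal_power mul x 1 = x"
  by (simp add: principal_power_def)

lemma principal_power_Suc:
  "i \<ge> 1 \<Longrightarrow> principal_power mul x (i + 1) = mul x (principal_power mul x i)"
  by (cases i) (simp_all add: principal_power_def)

locale nilalgebra = nonassoc_algebra +
  assumes nil: "\<exists>n\<ge>1. \<forall>y. principal_power (\<cdot>) y n = 0"

end

theory Submission
  imports Defs
begin

text \<open>Both conclusions come from the Jacobi identity with repeated arguments. With \<open>x, x, x\<close> it
  reads \<open>3 x\<^sup>3 = 0\<close>; as \<open>3\<close> is invertible in \<open>K\<close>, all principal cubes vanish, so the algebra
  is nil (\<open>cube_eq_0\<close>). With \<open>x, x, y\<close> it reads \<open>x\<^sup>2 y = - 2 x (x y)\<close> (\<open>square_mul\<close>): writing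
  \<open>L\<close> for multiplication by \<open>x\<close>, multiplication by \<open>x\<^sup>2\<close> is \<open>- 2 L\<^sup>2\<close>. This operator commutes with
  \<open>L\<close>, which is exactly the Jordan identity.\<close>

lemma three_neq_0_if_CHAR_neq_3:
  assumes "CHAR('k::field) \<noteq> 3"
  shows "(3::'k) \<noteq> 0"
proof
  assume "(3::'k) = 0"
  then have "CHAR('k) dvd 3"
    using of_nat_eq_0_iff_char_dvd[of 3, where 'a = 'k] by simp
  moreover have "CHAR('k) \<noteq> 1"
    by simp
  moreover have "CHAR('k) \<le> 3" "CHAR('k) \<noteq> 0"
    using \<open>CHAR('k) dvd 3\<close> by (auto dest: dvd_imp_le intro!: Nat.gr0I)
  moreover have "\<not> (2::nat) dvd 3"
    by simp
  ultimately show False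
    using assms by (metis One_nat_def Suc_1 le_SucE le_zero_eq numeral_3_eq_3)
qed

context jacobi_jordan_algebra
begin

lemma square_mul: "(x \<cdot> x) \<cdot> y = - (x \<cdot> (x \<cdot> y) + x \<cdot> (x \<cdot> y))"
proof -
  have "x \<cdot> (x \<cdot> y) + x \<cdot> (x \<cdot> y) + (x \<cdot> x) \<cdot> y = 0"
    using jacobi[of x x y] mul_comm[of y x] mul_comm[of y "x \<cdot> x"] by simp
  then show ?thesis
    by (simp only: eq_neg_iff_add_eq_0 add.commute)
qed

lemma jordan: "(x \<cdot> x) \<cdot> (y \<cdot> x) = ((x \<cdot> x) \<cdot> y) \<cdot> x"
proof -
  interpret L: Vector_Spaces.linear scale scale "\<lambda>y. x \<cdot> y"
    by (rule linear_mul_right)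
  have "(x \<cdot> x) \<cdot> (x \<cdot> y) = x \<cdot> ((x \<cdot> x) \<cdot> y)"
    by (simp add: square_mul L.neg L.add L.diff)
  then show ?thesis
    by (simp only: mul_comm[of y x] mul_comm[of "(x \<cdot> x) \<cdot> y" x])
qed

lemma cube_eq_0:
  assumes "(3::'a) \<noteq> 0"
  shows "x \<cdot> (x \<cdot> x) = 0"
proof -
  have "scale 3 (x \<cdot> (x \<cdot> x)) = scale (1 + 1 + 1) (x \<cdot> (x \<cdot> x))"
    by simp
  also have "\<dots> = 0"
    using jacobi[of x x x] unfolding scale_left_distrib scale_one .
  finally show ?thesis
    using assms by simp
qed

end

theorem lemma2p2:
  fixes scale :: "'k::field \<Rightarrow> 'v::ab_group_add \<Rightarrow> 'v"
    and mul :: "'v \<Rightarrow> 'v \<Rightarrow> 'v"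
  assumes "CHAR('k) \<noteq> 2" and "CHAR('k) \<noteq> 3"
    and "jacobi_jordan_algebra scale mul"
    and "finite_dimensional scale"
  shows "commutative_algebra scale mul \<and> nilalgebra scale mul \<and> jordan_algebra scale mul"
proof -
  interpret jacobi_jordan_algebra scale mul
    by fact
  have "principal_power mul y 3 = 0" for y
    using cube_eq_0[OF three_neq_0_if_CHAR_neq_3[OF assms(2)]]
    by (simp add: principal_power_def numeral_2_eq_2)
  then have "nilalgebra scale mul"
    by unfold_locales (auto intro!: exI[of _ 3])
  moreover have "jordan_algebra scale mul"
    by unfold_locales (rule jordan)
  ultimately show ?thesis
    using commutative_algebra_axioms by blast
qed

end
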